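(* Let $(X_0,X_1)_X$ be a pair of compatible metric spaces, $\theta\in(0,1)$ and $q\in[1,\infty]$. Then the functional $\delta_{\theta,q}$ is a metric on $X_0\cap X_1$.
   Context: Compatible pair: $X_0,X_1\subseteq X$ with $X_0\cap X_1\neq\emptyset$, and $d_0,d_1,d_X$ are metrics on $X_0,X_1,X$ such that for some constants $C_0,C_1>0$ one has $d_X(x,y)\le C_i\,d_i(x,y)$ for all $x,y\in X_i$, $i\in\{0,1\}$. This is denoted $(X_0,X_1)_X$. For $t>0$ and $(x,y)\in X_0^2\cup X_1^2$, the hop functional is $h_t(x,y)=\min\{d_0(x,y),t\,d_1(x,y)\}$ if $x,y\in X_0\cap X_1$; $h_t(x,y)=d_0(x,y)$ if $x,y\in X_0$ are not both in $X_1$; $h_t(x,y)=t\,d_1(x,y)$ if $x,y\in X_1$ are not both in $X_0$. An admissible linking sequence from $x$ to $y$ is a finite sequence $x_0=x,x_1,\dots,x_n=y$ in $X_0\cup X_1$ with $(x_k,x_{k+1})\in X_0^2\cup X_1^2$ for every $k$. Define $K_M(t;x,y)=\inf\sum_{k=0}^{n-1}h_t(x_k,x_{k+1})$ over all admissible linking sequences from $x$ to $y$; it is a metric on $X_0\cup X_1$, denoted $K_M(t)$. For $x,y\in X_0\cap X_1$ define $J_M(t;x,y)=\max\{d_0(x,y),t\,d_1(x,y)\}$, a metric on $X_0\cap X_1$, denoted $J_M(t)$. For a real sequence $(a_k)_{k\in\mathbb Z}$, $\Gamma_{\theta,q}((a_k))=\big[\sum_{k\in\mathbb Z}(2^{-k\theta}|a_k|)^q\big]^{1/q}$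 if $q<\infty$ and $\Gamma_{\theta,\infty}((a_k))=\sup_{k\in\mathbb Z}2^{-k\theta}|a_k|$ (values in $[0,\infty]$). An approximating sequence of $x\in X_0\cap X_1$ in $(X_0\cap X_1,J_M(1))$ is a sequence $(x_n)_{n\ge0}$ in $X_0\cap X_1$ that is Cauchy for $J_M(1)$ and satisfies $K_M(1;x_n,x)\to0$. Given approximating sequences $(x_n)$ of $x$ and $(y_n)$ of $y$, define $S^{x,y}_k=x_k$ for $k\ge0$ and $S^{x,y}_k=y_{-k}$ for $k<0$. Then $$p_{\theta,q}(x,y)=\inf\Gamma_{\theta,q}\big((J_M(2^k;S^{x,y}_k,S^{x,y}_{k+1}))_{k\in\mathbb Z}\big),$$ the infimum being over all approximating sequences $(x_n)$ of $x$ and $(y_n)$ of $y$. Further, $P_{\theta,q}(x,y)=\tfrac12\big(p_{\theta,q}(x,y)+p_{\theta,q}(y,x)\big)$ and $$\delta_{\theta,q}(x,y)=\inf\sum_{j=0}^{n-1}P_{\theta,q}(x_j,x_{j+1}),$$ the infimum being over all finite sequences $x_0=x,x_1,\dots,x_n=y$ of points of $X_0\cap X_1$. *)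

theory Defs
  imports "HOL-Analysis.Analysis"
begin

locale compatible_pair =
  M0: Metric_space X0 d0 + M1: Metric_space X1 d1 + MX: Metric_space X dX
  for X0 :: "'a set" and d0 :: "'a \<Rightarrow> 'a \<Rightarrow> real"
    and X1 :: "'a set" and d1 :: "'a \<Rightarrow> 'a \<Rightarrow> real"
    and X :: "'a set" and dX :: "'a \<Rightarrow> 'a \<Rightarrow> real" +
  assumes X0_subset: "X0 \<subseteq> X"
    and X1_subset: "X1 \<subseteq> X"
    and inter_nonempty: "X0 \<inter> X1 \<noteq> {}"
    and dominated0: "\<exists>C0>0. \<forall>x\<in>X0. \<forall>y\<in>X0. dX x y \<le> C0 * d0 x y"
    and dominated1: "\<exists>C1>0. \<forall>x\<in>X1. \<forall>y\<in>X1. dX x y \<le> C1 * d1 x y"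

text \<open>In the definitions below, \<open>X0 d0 X1 d1\<close> are the data of the pair. The hop functional
  is only meaningful on pairs of points lying in a common \<open>Xi\<close>.\<close>

definition hop ::
  "'a set \<Rightarrow> ('a \<Rightarrow> 'a \<Rightarrow> real) \<Rightarrow> 'a set \<Rightarrow> ('a \<Rightarrow> 'a \<Rightarrow> real) \<Rightarrow> real \<Rightarrow> 'a \<Rightarrow> 'a \<Rightarrow> real"
  where
  "hop X0 d0 X1 d1 t x y =
     (if x \<in> X0 \<inter> X1 \<and> y \<in> X0 \<inter> X1 then min (d0 x y) (t * d1 x y)
      else if x \<in> X0 \<and> y \<in> X0 then d0 x y
      else t * d1 x y)"

definition linking_seq :: "'a set \<Rightarrow> 'a set \<Rightarrow> 'a \<Rightarrow> 'a \<Rightarrow> nat \<Rightarrow> (nat \<Rightarrow> 'a) \<Rightarrow> bool"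
  where
  "linking_seq X0 X1 x y n s \<longleftrightarrow>
     1 \<le> n \<and> s 0 = x \<and> s n = y \<and> (\<forall>k\<le>n. s k \<in> X0 \<union> X1) \<and>
     (\<forall>k<n. (s k, s (Suc k)) \<in> X0 \<times> X0 \<union> X1 \<times> X1)"

definition K_M ::
  "'a set \<Rightarrow> ('a \<Rightarrow> 'a \<Rightarrow> real) \<Rightarrow> 'a set \<Rightarrow> ('a \<Rightarrow> 'a \<Rightarrow> real) \<Rightarrow> real \<Rightarrow> 'a \<Rightarrow> 'a \<Rightarrow> real"
  where
  "K_M X0 d0 X1 d1 t x y =
     Inf {\<Sum>k<n. hop X0 d0 X1 d1 t (s k) (s (Suc k)) | n s. linking_seq X0 X1 x y n s}"

definition J_M :: "('a \<Rightarrow> 'a \<Rightarrow> real) \<Rightarrow> ('a \<Rightarrow> 'a \<Rightarrow> real) \<Rightarrow> real \<Rightarrow> 'a \<Rightarrow> 'a \<Rightarrow> real"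
  where
  "J_M d0 d1 t x y = max (d0 x y) (t * d1 x y)"

text \<open>The sum is a sum of nonnegative reals; it has the value \<open>\<infinity>\<close> exactly when the family
  is not summable.\<close>

definition Gamma_seq :: "real \<Rightarrow> ereal \<Rightarrow> (int \<Rightarrow> real) \<Rightarrow> ennreal"
  where
  "Gamma_seq \<theta> q a =
     (if q = \<infinity> then (SUP k. ennreal (2 powr (- of_int k * \<theta>) * \<bar>a k\<bar>))
      else if (\<lambda>k. (2 powr (- of_int k * \<theta>) * \<bar>a k\<bar>) powr real_of_ereal q) summable_on UNIV
      then ennreal ((\<Sum>\<^sub>\<infinity>k. (2 powr (- of_int k * \<theta>) * \<bar>a k\<bar>) powr real_of_ereal q)
                      powr (1 / real_of_ereal q))
      else \<infinity>)"

text \<open>\<open>MCauchy\<close> includes the requirement that the sequence takes its values in \<open>X0 \<inter> X1\<close>.\<close>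

definition approximating_seq ::
  "'a set \<Rightarrow> ('a \<Rightarrow> 'a \<Rightarrow> real) \<Rightarrow> 'a set \<Rightarrow> ('a \<Rightarrow> 'a \<Rightarrow> real) \<Rightarrow> 'a \<Rightarrow> (nat \<Rightarrow> 'a) \<Rightarrow> bool"
  where
  "approximating_seq X0 d0 X1 d1 x u \<longleftrightarrow>
     Metric_space.MCauchy (X0 \<inter> X1) (J_M d0 d1 1) u \<and>
     (\<lambda>n. K_M X0 d0 X1 d1 1 (u n) x) \<longlonglongrightarrow> 0"

definition join_seq :: "(nat \<Rightarrow> 'a) \<Rightarrow> (nat \<Rightarrow> 'a) \<Rightarrow> int \<Rightarrow> 'a"
  where
  "join_seq u v k = (if 0 \<le> k then u (nat k) else v (nat (- k)))"

definition p_fun ::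
  "'a set \<Rightarrow> ('a \<Rightarrow> 'a \<Rightarrow> real) \<Rightarrow> 'a set \<Rightarrow> ('a \<Rightarrow> 'a \<Rightarrow> real) \<Rightarrow> real \<Rightarrow> ereal \<Rightarrow> 'a \<Rightarrow> 'a \<Rightarrow> ennreal"
  where
  "p_fun X0 d0 X1 d1 \<theta> q x y =
     Inf {Gamma_seq \<theta> q (\<lambda>k. J_M d0 d1 (2 powi k) (join_seq u v k) (join_seq u v (k + 1))) | u v.
            approximating_seq X0 d0 X1 d1 x u \<and> approximating_seq X0 d0 X1 d1 y v}"

definition P_fun ::
  "'a set \<Rightarrow> ('a \<Rightarrow> 'a \<Rightarrow> real) \<Rightarrow> 'a set \<Rightarrow> ('a \<Rightarrow> 'a \<Rightarrow> real) \<Rightarrow> real \<Rightarrow> ereal \<Rightarrow> 'a \<Rightarrow> 'a \<Rightarrow> ennreal"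
  where
  "P_fun X0 d0 X1 d1 \<theta> q x y =
     (p_fun X0 d0 X1 d1 \<theta> q x y + p_fun X0 d0 X1 d1 \<theta> q y x) / 2"

definition delta ::
  "'a set \<Rightarrow> ('a \<Rightarrow> 'a \<Rightarrow> real) \<Rightarrow> 'a set \<Rightarrow> ('a \<Rightarrow> 'a \<Rightarrow> real) \<Rightarrow> real \<Rightarrow> ereal \<Rightarrow> 'a \<Rightarrow> 'a \<Rightarrow> ennreal"
  where
  "delta X0 d0 X1 d1 \<theta> q x y =
     Inf {\<Sum>j<n. P_fun X0 d0 X1 d1 \<theta> q (s j) (s (Suc j)) | n s.
            1 \<le> n \<and> s 0 = x \<and> s n = y \<and> (\<forall>j\<le>n. s j \<in> X0 \<inter> X1)}"

end

theory Submission
  imports Defs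
begin

text \<open>Definiteness is the only substantial point. Along a joined sequence \<open>S\<close> one has
  \<open>dX (S k) (S (k+1)) \<le> C min(1, 2^(-k)) J_M(2^k)\<close>, and every single weighted term
  \<open>2^(-k\<theta>) J_M(2^k)\<close> is at most \<open>\<Gamma>\<close>. Since the weights \<open>min(1, 2^(-k)) 2^(k\<theta>)\<close> decay
  geometrically in both directions, summing up and passing to the limit (\<open>K_M(1)\<close> dominates a
  multiple of \<open>dX\<close>) gives \<open>c dX x y \<le> p x y\<close>, and a lower bound by a metric is inherited by the
  chain infimum \<open>\<delta>\<close>. Finiteness comes from the sequences that are constantly \<open>x\<close> and \<open>y\<close>.\<close>

section \<open>Finite sums and the weighted sequence norm\<close>

lemma (in Metric_space) mdist_le_sum:
  assumes "\<And>k. k \<le> n \<Longrightarrow> s k \<in> M"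
  shows "d (s 0) (s n) \<le> (\<Sum>k<n. d (s k) (s (Suc k)))"
  using assms
proof (induction n)
  case 0
  then show ?case by simp
next
  case (Suc n)
  have "d (s 0) (s (Suc n)) \<le> d (s 0) (s n) + d (s n) (s (Suc n))"
    by (intro triangle) (use Suc.prems in auto)
  also have "d (s 0) (s n) \<le> (\<Sum>k<n. d (s k) (s (Suc k)))"
    using Suc by simp
  finally show ?case by simp
qed

lemma sum_lessThan_add:
  fixes f :: "nat \<Rightarrow> 'a::comm_monoid_add"
  shows "(\<Sum>j<m + n. f j) = (\<Sum>j<m. f j) + (\<Sum>j<n. f (m + j))"
  by (induction n) (simp_all add: add.assoc)

lemma ereal_ge_1_cases:
  assumes "1 \<le> (q::ereal)"
  obtains "q = \<infinity>" | r where "q = ereal r" "1 \<le> r"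
  using assms by (cases q) (auto simp: one_ereal_def)

text \<open>For finite \<open>q\<close> one term of a nonnegative summable family is at most the
  whole sum, and taking roots is monotone; a family that is not summable has norm
  \<infinity>.\<close>

lemma term_le_Gamma_seq:
  assumes "1 \<le> q"
  shows "ennreal (2 powr (- of_int k * \<theta>) * \<bar>a k\<bar>) \<le> Gamma_seq \<theta> q a"
  using assms
proof (cases rule: ereal_ge_1_cases)
  case 1
  then show ?thesis by (auto simp: Gamma_seq_def intro!: SUP_upper)
next
  case (2 r)
  define b where "b k = 2 powr (- of_int k * \<theta>) * \<bar>a k\<bar>" for k :: int
  have b0: "0 \<le> b k" for k by (simp add: b_def)
  have "ennreal (b k) \<le> ennreal ((\<Sum>\<^sub>\<infinity>k. b k powr r) powr (1 / r))"
    if sm: "(\<lambda>k. b k powr r) summable_on UNIV"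
  proof (rule ennreal_leI)
    have "b k powr r \<le> (\<Sum>\<^sub>\<infinity>k. b k powr r)"
      using finite_sum_le_infsum[OF sm, of "{k}"] by simp
    then have "(b k powr r) powr (1 / r) \<le> (\<Sum>\<^sub>\<infinity>k. b k powr r) powr (1 / r)"
      using 2 by (intro powr_mono2) auto
    then show "b k \<le> (\<Sum>\<^sub>\<infinity>k. b k powr r) powr (1 / r)"
      using 2 b0 by (simp add: powr_powr)
  qed
  then show ?thesis
    using 2 by (simp add: Gamma_seq_def b_def)
qed

text \<open>Supplies the upper bound for joined sequences with only finitely many nonconstant
  steps.\<close>

lemma Gamma_seq_finite_support:
  assumes "1 \<le> q" and fin: "finite {k. a k \<noteq> 0}"
  shows "Gamma_seq \<theta> q a < \<infinity>"
  using assms(1)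
proof (cases rule: ereal_ge_1_cases)
  case 1
  define A where "A = (\<lambda>k. 2 powr (- of_int k * \<theta>) * \<bar>a k\<bar>) ` {k. a k \<noteq> 0}"
  have "finite A" using fin by (simp add: A_def)
  \<comment> \<open>Inserting 0 makes the maximum exist when the support is empty and covers the
    indices outside it.\<close>
  have "2 powr (- of_int k * \<theta>) * \<bar>a k\<bar> \<le> Max (insert 0 A)" for k
    using \<open>finite A\<close> by (cases "a k = 0") (auto intro!: Max_ge simp: A_def)
  then have "(SUP k. ennreal (2 powr (- of_int k * \<theta>) * \<bar>a k\<bar>)) \<le> ennreal (Max (insert 0 A))"
    by (intro SUP_least ennreal_leI)
  also have "\<dots> < \<infinity>" by simp
  finally show ?thesis using 1 by (simp add: Gamma_seq_def)
next
  case (2 r)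
  let ?f = "\<lambda>k. (2 powr (- of_int k * \<theta>) * \<bar>a k\<bar>) powr r"
  have "?f summable_on UNIV \<longleftrightarrow> ?f summable_on {k. a k \<noteq> 0}"
    by (rule summable_on_cong_neutral) auto
  then have "?f summable_on UNIV" using fin by simp
  then show ?thesis using 2 by (simp add: Gamma_seq_def)
qed

lemma Gamma_seq_zero [simp]: "Gamma_seq \<theta> q (\<lambda>_. 0) = 0"
  by (simp add: Gamma_seq_def)

section \<open>The chain infimum: triangle inequality and symmetry\<close>

lemma delta_le:
  assumes "1 \<le> n" "s 0 = x" "s n = y" "\<And>j. j \<le> n \<Longrightarrow> s j \<in> X0 \<inter> X1"
  shows "delta X0 d0 X1 d1 \<theta> q x y \<le> (\<Sum>j<n. P_fun X0 d0 X1 d1 \<theta> q (s j) (s (Suc j)))"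
  unfolding delta_def using assms by (intro Inf_lower) auto

lemma delta_less_obtain:
  assumes "delta X0 d0 X1 d1 \<theta> q x y < e"
  obtains n s where "1 \<le> n" "s 0 = x" "s n = y" "\<And>j. j \<le> n \<Longrightarrow> s j \<in> X0 \<inter> X1"
    "(\<Sum>j<n. P_fun X0 d0 X1 d1 \<theta> q (s j) (s (Suc j))) < e"
  using assms unfolding delta_def Inf_less_iff by blast

lemma P_fun_commute: "P_fun X0 d0 X1 d1 \<theta> q x y = P_fun X0 d0 X1 d1 \<theta> q y x"
  by (simp add: P_fun_def add.commute)

lemma delta_le_P_fun:
  assumes "x \<in> X0 \<inter> X1" "y \<in> X0 \<inter> X1"
  shows "delta X0 d0 X1 d1 \<theta> q x y \<le> P_fun X0 d0 X1 d1 \<theta> q x y"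
  using delta_le[of 1 "\<lambda>j. if j = 0 then x else y" x y] assms by simp

text \<open>Chains from \<open>x\<close> to \<open>y\<close> and from \<open>y\<close> to
  \<open>z\<close> that are optimal up to \<open>e / 2\<close> are concatenated. An infinite
  right-hand side leaves nothing to prove.\<close>

lemma delta_triangle:
  "delta X0 d0 X1 d1 \<theta> q x z \<le> delta X0 d0 X1 d1 \<theta> q x y + delta X0 d0 X1 d1 \<theta> q y z"
proof (rule ennreal_le_epsilon)
  let ?D = "delta X0 d0 X1 d1 \<theta> q" and ?P = "P_fun X0 d0 X1 d1 \<theta> q"
  fix e :: real
  assume fin: "?D x y + ?D y z < top" and e: "0 < e"
  have less: "D < D + ennreal (e / 2)" if "D < top" for D
    using that e by (simp add: ennreal_add_left_cancel_less[of D 0, simplified])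
  from fin have fin': "?D x y < top" "?D y z < top" by (auto simp: less_top)
  from delta_less_obtain[OF less[OF fin'(1)]] obtain m s where
    s: "1 \<le> m" "s 0 = x" "s m = y" "\<And>j. j \<le> m \<Longrightarrow> s j \<in> X0 \<inter> X1"
    "(\<Sum>j<m. ?P (s j) (s (Suc j))) < ?D x y + ennreal (e / 2)" by blast
  from delta_less_obtain[OF less[OF fin'(2)]] obtain n t where
    t: "1 \<le> n" "t 0 = y" "t n = z" "\<And>j. j \<le> n \<Longrightarrow> t j \<in> X0 \<inter> X1"
    "(\<Sum>j<n. ?P (t j) (t (Suc j))) < ?D y z + ennreal (e / 2)" by blast
  \<comment> \<open>At the seam \<open>j = m\<close> both branches have the value \<open>y\<close>,
    which gives the shift identity for \<open>j = 0\<close> as well.\<close>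
  define w where "w j = (if j \<le> m then s j else t (j - m))" for j
  have w: "w (m + j) = t j" for j
    using s t by (simp add: w_def)
  have "?D x z \<le> (\<Sum>j<m + n. ?P (w j) (w (Suc j)))"
    using s t by (intro delta_le) (auto simp: w_def)
  also have "\<dots> = (\<Sum>j<m. ?P (s j) (s (Suc j))) + (\<Sum>j<n. ?P (t j) (t (Suc j)))"
    unfolding sum_lessThan_add using w[of "Suc _"] by (simp add: w) (simp add: w_def)
  also have "\<dots> \<le> (?D x y + ennreal (e / 2)) + (?D y z + ennreal (e / 2))"
    using s t by (intro add_mono) auto
  also have "\<dots> = ?D x y + ?D y z + (ennreal (e / 2) + ennreal (e / 2))"
    by (simp add: algebra_simps)
  also have "ennreal (e / 2) + ennreal (e / 2) = ennreal e"
    using e by (subst ennreal_plus[symmetric]) auto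
  finally show "?D x z \<le> ?D x y + ?D y z + ennreal e" .
qed

text \<open>Each chain can be run backwards at the same cost, because \<open>P_fun\<close> is
  symmetric.\<close>

lemma delta_le_reverse: "delta X0 d0 X1 d1 \<theta> q x y \<le> delta X0 d0 X1 d1 \<theta> q y x"
  unfolding delta_def[of _ _ _ _ _ _ y x]
proof (rule Inf_greatest, safe)
  let ?P = "P_fun X0 d0 X1 d1 \<theta> q"
  fix n :: nat and s :: "nat \<Rightarrow> 'a"
  assume s: "1 \<le> n" "\<forall>j\<le>n. s j \<in> X0 \<inter> X1" "y = s 0" "x = s n"
  have "delta X0 d0 X1 d1 \<theta> q (s n) (s 0) \<le> (\<Sum>j<n. ?P (s (n - j)) (s (n - Suc j)))"
    using s by (intro delta_le) auto
  also have "\<dots> = (\<Sum>j<n. ?P (s (n - Suc j)) (s (Suc (n - Suc j))))"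
    by (intro sum.cong refl) (simp add: P_fun_commute Suc_diff_Suc)
  also have "\<dots> = (\<Sum>j<n. ?P (s j) (s (Suc j)))"
    by (rule sum.nat_diff_reindex)
  finally show "delta X0 d0 X1 d1 \<theta> q (s n) (s 0) \<le> (\<Sum>j<n. ?P (s j) (s (Suc j)))" .
qed

lemma delta_commute: "delta X0 d0 X1 d1 \<theta> q x y = delta X0 d0 X1 d1 \<theta> q y x"
  by (intro antisym delta_le_reverse)

section \<open>The metric \<open>J_M\<close>, the lower bound for \<open>K_M\<close>, and
  approximating sequences\<close>

context compatible_pair
begin

text \<open>Opens the theory of \<open>MCauchy\<close> for \<open>J_M d0 d1 1\<close>. Both
  arguments of the maximum satisfy the triangle inequality, and \<open>d0\<close> alone separates
  points.\<close>

lemma Metric_space_J_M: "0 < t \<Longrightarrow> Metric_space (X0 \<inter> X1) (J_M d0 d1 t)"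
proof
  fix x y z
  assume t: "0 < t"
  show "0 \<le> J_M d0 d1 t x y" by (simp add: J_M_def le_max_iff_disj)
  show "J_M d0 d1 t x y = J_M d0 d1 t y x" by (simp add: J_M_def M0.commute M1.commute)
  show "J_M d0 d1 t x y = 0 \<longleftrightarrow> x = y" if "x \<in> X0 \<inter> X1" "y \<in> X0 \<inter> X1"
  proof
    assume "J_M d0 d1 t x y = 0"
    then have "d0 x y \<le> 0" by (simp add: J_M_def max_def split: if_splits)
    then show "x = y" using that M0.zero[of x y] M0.nonneg[of x y] by simp
  qed (use that in \<open>simp add: J_M_def\<close>)
  show "J_M d0 d1 t x z \<le> J_M d0 d1 t x y + J_M d0 d1 t y z"
    if "x \<in> X0 \<inter> X1" "y \<in> X0 \<inter> X1" "z \<in> X0 \<inter> X1"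
  proof -
    have "d0 x z \<le> d0 x y + d0 y z" using that by (intro M0.triangle) auto
    moreover have "t * d1 x z \<le> t * d1 x y + t * d1 y z"
      using that t M1.triangle[of x y z] by (simp flip: distrib_left)
    ultimately show ?thesis unfolding J_M_def by linarith
  qed
qed

lemma approximating_seq_range:
  assumes "approximating_seq X0 d0 X1 d1 x u"
  shows "u n \<in> X0 \<inter> X1"
proof -
  interpret J: Metric_space "X0 \<inter> X1" "J_M d0 d1 1" by (rule Metric_space_J_M) simp
  show ?thesis using assms by (auto simp: approximating_seq_def J.MCauchy_def)
qed

lemma linking_seq_single:
  "x \<in> X0 \<inter> X1 \<Longrightarrow> y \<in> X0 \<inter> X1 \<Longrightarrow> linking_seq X0 X1 x y 1 (\<lambda>k. if k = 0 then x else y)"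
  by (simp add: linking_seq_def)

text \<open>The larger of the two domination constants serves both spaces, so that later estimates
  treat them alike.\<close>

lemma dominated:
  obtains C where "0 < C"
    "\<And>x y. x \<in> X0 \<Longrightarrow> y \<in> X0 \<Longrightarrow> dX x y \<le> C * d0 x y"
    "\<And>x y. x \<in> X1 \<Longrightarrow> y \<in> X1 \<Longrightarrow> dX x y \<le> C * d1 x y"
proof -
  obtain C0 C1 where C: "C0 > 0" "\<forall>x\<in>X0. \<forall>y\<in>X0. dX x y \<le> C0 * d0 x y"
    "C1 > 0" "\<forall>x\<in>X1. \<forall>y\<in>X1. dX x y \<le> C1 * d1 x y"
    using dominated0 dominated1 by blast
  show thesis
  proof (rule that[of "max C0 C1"])
    show "0 < max C0 C1" using C by simp
    fix x y
    have "C0 * d0 x y \<le> max C0 C1 * d0 x y" "C1 * d1 x y \<le> max C0 C1 * d1 x y"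
      by (auto intro!: mult_right_mono)
    then show "x \<in> X0 \<Longrightarrow> y \<in> X0 \<Longrightarrow> dX x y \<le> max C0 C1 * d0 x y"
      and "x \<in> X1 \<Longrightarrow> y \<in> X1 \<Longrightarrow> dX x y \<le> max C0 C1 * d1 x y"
      using C by (meson order_trans)+
  qed
qed

text \<open>At \<open>t = 1\<close> every admissible hop costs at least \<open>dX / C\<close>,
  whichever branch of \<open>hop\<close> applies; the triangle inequality for \<open>dX\<close> then
  bounds every linking sequence.\<close>

lemma K_M_ge:
  assumes "0 < C"
    and C0: "\<And>x y. x \<in> X0 \<Longrightarrow> y \<in> X0 \<Longrightarrow> dX x y \<le> C * d0 x y"
    and C1: "\<And>x y. x \<in> X1 \<Longrightarrow> y \<in> X1 \<Longrightarrow> dX x y \<le> C * d1 x y"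
    and x: "x \<in> X0 \<inter> X1" and y: "y \<in> X0 \<inter> X1"
  shows "dX x y / C \<le> K_M X0 d0 X1 d1 1 x y"
  unfolding K_M_def
proof (rule cInf_greatest)
  show "{\<Sum>k<n. hop X0 d0 X1 d1 1 (s k) (s (Suc k)) |n s. linking_seq X0 X1 x y n s} \<noteq> {}"
    using linking_seq_single[OF x y] by blast
next
  fix S
  assume "S \<in> {\<Sum>k<n. hop X0 d0 X1 d1 1 (s k) (s (Suc k)) |n s. linking_seq X0 X1 x y n s}"
  then obtain n s where S: "S = (\<Sum>k<n. hop X0 d0 X1 d1 1 (s k) (s (Suc k)))"
    and l: "linking_seq X0 X1 x y n s" by blast
  have "dX x y \<le> (\<Sum>k<n. dX (s k) (s (Suc k)))"
    using l X0_subset X1_subset MX.mdist_le_sum[of n s] by (auto simp: linking_seq_def)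
  also have "\<dots> \<le> (\<Sum>k<n. C * hop X0 d0 X1 d1 1 (s k) (s (Suc k)))"
  proof (rule sum_mono)
    fix k assume "k \<in> {..<n}"
    then have "s k \<in> X0 \<and> s (Suc k) \<in> X0 \<or> s k \<in> X1 \<and> s (Suc k) \<in> X1"
      using l by (auto simp: linking_seq_def)
    then show "dX (s k) (s (Suc k)) \<le> C * hop X0 d0 X1 d1 1 (s k) (s (Suc k))"
      using C0 C1 by (auto simp: hop_def min_def)
  qed
  also have "\<dots> = C * S" by (simp add: S sum_distrib_left)
  finally show "dX x y / C \<le> S" using \<open>0 < C\<close> by (simp add: field_simps)
qed

lemma approximating_seq_tendsto_dX:
  assumes "approximating_seq X0 d0 X1 d1 x u" "x \<in> X0 \<inter> X1"
  shows "(\<lambda>n. dX (u n) x) \<longlonglongrightarrow> 0"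
proof -
  obtain C where C: "0 < C"
    "\<And>x y. x \<in> X0 \<Longrightarrow> y \<in> X0 \<Longrightarrow> dX x y \<le> C * d0 x y"
    "\<And>x y. x \<in> X1 \<Longrightarrow> y \<in> X1 \<Longrightarrow> dX x y \<le> C * d1 x y"
    by (fact dominated)
  have *: "(\<lambda>n. C * K_M X0 d0 X1 d1 1 (u n) x) \<longlonglongrightarrow> 0"
    using assms(1) by (intro tendsto_mult_right_zero) (simp add: approximating_seq_def)
  show ?thesis
  proof (rule tendsto_sandwich[OF _ _ tendsto_const *])
    have "dX (u n) x \<le> C * K_M X0 d0 X1 d1 1 (u n) x" for n
      using K_M_ge[OF C approximating_seq_range[OF assms(1)] assms(2), of n] \<open>0 < C\<close>
      by (simp add: field_simps)
    then show "\<forall>\<^sub>F n in sequentially. dX (u n) x \<le> C * K_M X0 d0 X1 d1 1 (u n) x" by simp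
  qed simp
qed

text \<open>Constant sequences are the competitors behind all upper bounds for
  \<open>p_fun\<close>.\<close>

lemma approximating_seq_const:
  assumes "x \<in> X0 \<inter> X1"
  shows "approximating_seq X0 d0 X1 d1 x (\<lambda>_. x)"
proof -
  interpret J: Metric_space "X0 \<inter> X1" "J_M d0 d1 1" by (rule Metric_space_J_M) simp
  obtain C where C: "0 < C"
    "\<And>x y. x \<in> X0 \<Longrightarrow> y \<in> X0 \<Longrightarrow> dX x y \<le> C * d0 x y"
    "\<And>x y. x \<in> X1 \<Longrightarrow> y \<in> X1 \<Longrightarrow> dX x y \<le> C * d1 x y"
    by (fact dominated)
  have hop_nonneg: "0 \<le> hop X0 d0 X1 d1 1 y z" for y z by (simp add: hop_def)
  have "K_M X0 d0 X1 d1 1 x x \<le> 0"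
    unfolding K_M_def
  proof (rule cInf_lower)
    \<comment> \<open>Linking sequences have at least one hop, so the value 0 is realized by a
      single hop from \<open>x\<close> to itself.\<close>
    show "0 \<in> {\<Sum>k<n. hop X0 d0 X1 d1 1 (s k) (s (Suc k)) |n s. linking_seq X0 X1 x x n s}"
      using linking_seq_single[OF assms assms] assms
      by (intro CollectI exI[of _ 1] exI[of _ "\<lambda>_. x"]) (auto simp: hop_def)
    show "bdd_below {\<Sum>k<n. hop X0 d0 X1 d1 1 (s k) (s (Suc k)) |n s. linking_seq X0 X1 x x n s}"
      by (intro bdd_belowI[of _ 0]) (auto intro!: sum_nonneg hop_nonneg)
  qed
  moreover have "0 \<le> K_M X0 d0 X1 d1 1 x x"
    using K_M_ge[OF C assms assms] X0_subset assms by auto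
  moreover have "J.MCauchy (\<lambda>_. x)" using assms by (auto simp: J.MCauchy_def)
  ultimately show ?thesis by (simp add: approximating_seq_def)
qed

section \<open>Upper bounds for \<open>p_fun\<close>\<close>

lemma p_fun_le:
  assumes "approximating_seq X0 d0 X1 d1 x u" "approximating_seq X0 d0 X1 d1 y v"
  shows "p_fun X0 d0 X1 d1 \<theta> q x y
    \<le> Gamma_seq \<theta> q (\<lambda>k. J_M d0 d1 (2 powi k) (join_seq u v k) (join_seq u v (k + 1)))"
  unfolding p_fun_def using assms by (intro Inf_lower) auto

lemma p_fun_finite:
  assumes "1 \<le> q" "x \<in> X0 \<inter> X1" "y \<in> X0 \<inter> X1"
  shows "p_fun X0 d0 X1 d1 \<theta> q x y < \<infinity>"
proof -
  let ?S = "join_seq (\<lambda>_. x) (\<lambda>_. y)"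
  \<comment> \<open>The joined sequence is \<open>y\<close> at negative indices and \<open>x\<close>
    from 0 on, so its only possible jump is from -1 to 0.\<close>
  have "{k. J_M d0 d1 (2 powi k) (?S k) (?S (k + 1)) \<noteq> 0} \<subseteq> {-1}"
    using assms by (auto simp: join_seq_def J_M_def split: if_splits)
  then have "Gamma_seq \<theta> q (\<lambda>k. J_M d0 d1 (2 powi k) (?S k) (?S (k + 1))) < \<infinity>"
    using assms(1) by (intro Gamma_seq_finite_support) (auto intro: finite_subset)
  then show ?thesis
    using p_fun_le[OF approximating_seq_const approximating_seq_const] assms
    by (meson order_le_less_trans)
qed

lemma p_fun_refl:
  assumes "x \<in> X0 \<inter> X1"
  shows "p_fun X0 d0 X1 d1 \<theta> q x x = 0"
proof -
  have "J_M d0 d1 (2 powi k) x x = 0" for k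
    using assms by (simp add: J_M_def)
  then show ?thesis
    using p_fun_le[OF approximating_seq_const approximating_seq_const, of x x \<theta> q] assms
    by (simp add: join_seq_def)
qed

section \<open>The lower bound of \<open>p_fun\<close> by a multiple of \<open>dX\<close>\<close>

text \<open>The first bound uses the \<open>d0\<close> part of \<open>J_M\<close>, the second its
  \<open>d1\<close> part, which gains the factor \<open>2 powr (- k)\<close>. For 0 < \<theta> < 1
  and nonnegative \<open>G\<close> the first decays as \<open>k\<close> tends to minus infinity and
  the second as \<open>k\<close> tends to plus infinity.\<close>

lemma dX_step_le:
  assumes "0 < C"
    and C0: "\<And>x y. x \<in> X0 \<Longrightarrow> y \<in> X0 \<Longrightarrow> dX x y \<le> C * d0 x y"
    and C1: "\<And>x y. x \<in> X1 \<Longrightarrow> y \<in> X1 \<Longrightarrow> dX x y \<le> C * d1 x y"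
    and x: "x \<in> X0 \<inter> X1" and y: "y \<in> X0 \<inter> X1"
    and G: "2 powr (- of_int k * \<theta>) * J_M d0 d1 (2 powi k) x y \<le> G"
  shows "dX x y \<le> C * G * 2 powr (of_int k * \<theta>)"
    and "dX x y \<le> C * G * 2 powr (of_int k * (\<theta> - 1))"
proof -
  let ?J = "J_M d0 d1 (2 powi k) x y"
  have J: "?J \<le> G * 2 powr (of_int k * \<theta>)"
    using G by (simp add: powr_minus field_simps)
  have "C * d0 x y \<le> C * ?J" using \<open>0 < C\<close> by (simp add: J_M_def)
  also have "\<dots> \<le> C * (G * 2 powr (of_int k * \<theta>))" using \<open>0 < C\<close> J by simp
  finally show "dX x y \<le> C * G * 2 powr (of_int k * \<theta>)"
    using C0[of x y] x y by (simp add: mult.assoc)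
  have "2 powr of_int k * d1 x y \<le> ?J" by (simp add: J_M_def powr_real_of_int')
  then have "d1 x y \<le> ?J * 2 powr (- of_int k)"
    by (simp add: powr_minus field_simps)
  also have "\<dots> \<le> G * 2 powr (of_int k * \<theta>) * 2 powr (- of_int k)"
    using J by (intro mult_right_mono) auto
  also have "\<dots> = G * 2 powr (of_int k * (\<theta> - 1))"
    by (simp add: algebra_simps flip: powr_add)
  finally have "C * d1 x y \<le> C * (G * 2 powr (of_int k * (\<theta> - 1)))" using \<open>0 < C\<close> by simp
  then show "dX x y \<le> C * G * 2 powr (of_int k * (\<theta> - 1))"
    using C1[of x y] x y by (simp add: mult.assoc)
qed

lemma dX_le_geometric:
  assumes "\<And>k. s k \<in> X" "0 \<le> r" "r < 1" "0 \<le> B"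
    and "\<And>k. dX (s k) (s (Suc k)) \<le> B * r ^ k"
  shows "dX (s 0) (s n) \<le> B / (1 - r)"
proof -
  have "dX (s 0) (s n) \<le> (\<Sum>k<n. B * r ^ k)"
    using MX.mdist_le_sum[of n s] assms sum_mono[of "{..<n}" "\<lambda>k. dX (s k) (s (Suc k))"]
    by (meson order_trans)
  also have "\<dots> = B * (\<Sum>k<n. r ^ k)" by (simp add: sum_distrib_left)
  also have "(\<Sum>k<n. r ^ k) \<le> 1 / (1 - r)"
    using assms by (simp add: sum_gp_strict divide_right_mono)
  finally show ?thesis using \<open>0 \<le> B\<close> by (simp add: mult_left_mono)
qed

text \<open>The constant is chosen before the points, so that the bound can later be summed along
  chains.\<close>

lemma p_fun_ge:
  assumes \<theta>: "0 < \<theta>" "\<theta> < 1" and q: "1 \<le> q"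
  obtains c where "0 < c"
    "\<And>x y. x \<in> X0 \<inter> X1 \<Longrightarrow> y \<in> X0 \<inter> X1 \<Longrightarrow> ennreal (c * dX x y) \<le> p_fun X0 d0 X1 d1 \<theta> q x y"
proof -
  obtain C where C: "0 < C"
    "\<And>x y. x \<in> X0 \<Longrightarrow> y \<in> X0 \<Longrightarrow> dX x y \<le> C * d0 x y"
    "\<And>x y. x \<in> X1 \<Longrightarrow> y \<in> X1 \<Longrightarrow> dX x y \<le> C * d1 x y"
    by (fact dominated)
  \<comment> \<open>The decay ratios per step to the right and to the left of index 0; both are
    below 1 exactly because 0 < \<theta> < 1.\<close>
  define r1 r2 where "r1 = 2 powr (\<theta> - 1)" and "r2 = 2 powr (- \<theta>)"
  have r: "0 < r1" "r1 < 1" "0 < r2" "r2 < 1"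
    using \<theta> by (auto simp: r1_def r2_def powr_less_one)
  \<comment> \<open>Adds the two geometric series bounds, with the common factor \<open>G\<close>
    taken out.\<close>
  define W where "W = C / (1 - r1) + C / (1 - r2)"
  have W: "0 < W" using C r by (simp add: W_def add_pos_pos)
  have main: "dX x y \<le> W * G"
    if x: "x \<in> X0 \<inter> X1" and y: "y \<in> X0 \<inter> X1"
      and u: "approximating_seq X0 d0 X1 d1 x u" and v: "approximating_seq X0 d0 X1 d1 y v"
      and G: "0 \<le> G" "Gamma_seq \<theta> q (\<lambda>k. J_M d0 d1 (2 powi k) (join_seq u v k) (join_seq u v (k + 1)))
        = ennreal G" for x y u v G
  proof -
    let ?S = "join_seq u v"
    have S: "?S k \<in> X0 \<inter> X1" for k
      using approximating_seq_range u v by (metis join_seq_def)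
    then have SX: "?S k \<in> X" for k using X0_subset by auto
    have "2 powr (- of_int k * \<theta>) * J_M d0 d1 (2 powi k) (?S k) (?S (k + 1)) \<le> G" for k
    proof -
      \<comment> \<open>Nonnegativity removes the absolute value in
        \<open>Gamma_seq\<close>.\<close>
      have "0 \<le> J_M d0 d1 (2 powi k) (?S k) (?S (k + 1))"
        by (simp add: J_M_def le_max_iff_disj)
      then show ?thesis
        using term_le_Gamma_seq[OF q, of k \<theta>
            "\<lambda>k. J_M d0 d1 (2 powi k) (?S k) (?S (k + 1))"] G by simp
    qed
    note step = dX_step_le[OF C S S this]
    have right: "dX (?S 0) (?S (int n)) \<le> (C * G) / (1 - r1)" for n
    proof -
      have "dX (?S (int k)) (?S (int (Suc k))) \<le> C * G * r1 ^ k" for k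
      proof -
        have "2 powr (real k * (\<theta> - 1)) = r1 ^ k"
          by (simp add: r1_def powr_powr mult.commute flip: powr_realpow)
        then show ?thesis
          using step(2)[of "int k"] by (simp add: add.commute)
      qed
      then show ?thesis
        using dX_le_geometric[of "\<lambda>k. ?S (int k)" r1 "C * G" n] r C G SX by simp
    qed
    have left: "dX (?S 0) (?S (- int n)) \<le> (C * G) / (1 - r2)" for n
    proof -
      have "dX (?S (- int k)) (?S (- int (Suc k))) \<le> C * G * r2 ^ k" for k
      proof -
        \<comment> \<open>Going left from \<open>- k\<close> uses the step with index
          \<open>- (k + 1)\<close>. The surplus factor \<open>r2\<close> is dropped so that the
          geometric bound starts with exponent 0.\<close>
        have "dX (?S (- int k)) (?S (- int (Suc k))) \<le> C * G * 2 powr (- real (Suc k) * \<theta>)"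
          using step(1)[of "- int (Suc k)"] by (simp add: MX.commute)
        also have "\<dots> \<le> C * G * 2 powr (- real k * \<theta>)"
          using C G \<theta> by (intro mult_left_mono powr_mono) (auto simp: algebra_simps)
        also have "2 powr (- real k * \<theta>) = r2 ^ k"
          by (simp add: r2_def powr_powr mult.commute flip: powr_realpow)
        finally show ?thesis .
      qed
      then show ?thesis
        using dX_le_geometric[of "\<lambda>k. ?S (- int k)" r2 "C * G" n] r C G SX by simp
    qed
    have xX: "x \<in> X" "y \<in> X" using x y X0_subset by auto
    \<comment> \<open>Positivity of \<open>n\<close> matters: at index 0 the joined sequence takes
      the value \<open>u 0\<close>, so \<open>v 0\<close> does not occur in it. The path runs from
      \<open>x\<close> through \<open>u n\<close>, \<open>?S 0\<close> and \<open>v n\<close> to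
      \<open>y\<close>.\<close>
    have bound: "dX x y \<le> W * G + dX (u n) x + dX (v n) y" if "0 < n" for n
    proof -
      have e: "?S (int n) = u n" "?S (- int n) = v n" using that by (auto simp: join_seq_def)
      have "dX x y \<le> dX x (u n) + dX (u n) y"
        using SX[of "int n"] xX e by (intro MX.triangle) auto
      also have "dX (u n) y \<le> dX (u n) (?S 0) + dX (?S 0) y"
        using SX[of "int n"] SX[of 0] xX e by (intro MX.triangle) auto
      also have "dX (?S 0) y \<le> dX (?S 0) (v n) + dX (v n) y"
        using SX[of "- int n"] SX[of 0] xX e by (intro MX.triangle) auto
      finally have "dX x y \<le> dX (u n) x + dX (?S 0) (u n) + dX (?S 0) (v n) + dX (v n) y"
        by (simp add: MX.commute)
      moreover have "W * G = (C * G) / (1 - r1) + (C * G) / (1 - r2)"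
        by (simp add: W_def field_simps)
      ultimately show ?thesis using left[of n] right[of n] e by simp
    qed
    have "(\<lambda>n. W * G + dX (u n) x + dX (v n) y) \<longlonglongrightarrow> W * G + 0 + 0"
      by (intro tendsto_intros approximating_seq_tendsto_dX u v x y)
    then show "dX x y \<le> W * G"
      using bound by (intro LIMSEQ_le_const[where X = "\<lambda>n. W * G + dX (u n) x + dX (v n) y"]
          exI[of _ 1]) auto
  qed
  show thesis
  proof (rule that[of "1 / W"])
    show "0 < 1 / W" using W by simp
    fix x y assume xy: "x \<in> X0 \<inter> X1" "y \<in> X0 \<inter> X1"
    show "ennreal (1 / W * dX x y) \<le> p_fun X0 d0 X1 d1 \<theta> q x y"
      unfolding p_fun_def
    proof (rule Inf_greatest, safe)
      fix u v
      assume uv: "approximating_seq X0 d0 X1 d1 x u" "approximating_seq X0 d0 X1 d1 y v"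
      let ?g = "Gamma_seq \<theta> q
        (\<lambda>k. J_M d0 d1 (2 powi k) (join_seq u v k) (join_seq u v (k + 1)))"
      show "ennreal (1 / W * dX x y) \<le> ?g"
      \<comment> \<open>Only a finite norm gives a real \<open>G\<close> for \<open>main\<close>; an
        infinite one is trivially an upper bound.\<close>
      proof (cases ?g rule: ennreal_cases)
        case (real G)
        then have "dX x y \<le> W * G" using main[OF xy uv] by blast
        then have "1 / W * dX x y \<le> G" using W by (simp add: field_simps)
        then show ?thesis using real by (simp add: ennreal_leI)
      qed simp
    qed
  qed
qed

section \<open>The metric axioms for \<open>delta\<close>\<close>

lemma delta_finite:
  assumes "1 \<le> q" "x \<in> X0 \<inter> X1" "y \<in> X0 \<inter> X1"
  shows "delta X0 d0 X1 d1 \<theta> q x y < \<infinity>"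
proof -
  have "P_fun X0 d0 X1 d1 \<theta> q x y < \<infinity>"
    using p_fun_finite[OF assms] p_fun_finite[OF assms(1,3,2)]
    by (simp add: P_fun_def ennreal_divide_eq_top_iff less_top[symmetric])
  then show ?thesis
    using delta_le_P_fun[OF assms(2,3)] by (meson order_le_less_trans)
qed

lemma delta_refl:
  assumes "x \<in> X0 \<inter> X1"
  shows "delta X0 d0 X1 d1 \<theta> q x x = 0"
  using delta_le_P_fun[OF assms assms, of d0 d1 \<theta> q] assms by (simp add: P_fun_def p_fun_refl)

text \<open>The lower bound passes from \<open>p_fun\<close> to its symmetrization
  \<open>P_fun\<close>, and then to any chain by the triangle inequality for \<open>dX\<close>,
  since \<open>c\<close> is the same for every link.\<close>

lemma delta_ge:
  assumes "0 < c"
    and c: "\<And>x y. x \<in> X0 \<inter> X1 \<Longrightarrow> y \<in> X0 \<inter> X1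
      \<Longrightarrow> ennreal (c * dX x y) \<le> p_fun X0 d0 X1 d1 \<theta> q x y"
  shows "ennreal (c * dX x y) \<le> delta X0 d0 X1 d1 \<theta> q x y"
  unfolding delta_def
proof (rule Inf_greatest, safe)
  let ?P = "P_fun X0 d0 X1 d1 \<theta> q"
  have P: "ennreal (c * dX a b) \<le> ?P a b" if "a \<in> X0 \<inter> X1" "b \<in> X0 \<inter> X1" for a b
  proof -
    have "ennreal (c * dX a b) = (ennreal (c * dX a b) + ennreal (c * dX b a)) / 2"
      using \<open>0 < c\<close> by (simp add: MX.commute ennreal_divide_numeral flip: ennreal_plus)
    also have "\<dots> \<le> ?P a b"
      unfolding P_fun_def using that by (intro divide_right_mono_ennreal add_mono c)
    finally show ?thesis .
  qed
  fix n :: nat and s :: "nat \<Rightarrow> 'a"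
  assume s: "1 \<le> n" "\<forall>j\<le>n. s j \<in> X0 \<inter> X1"
  have "c * dX (s 0) (s n) \<le> c * (\<Sum>j<n. dX (s j) (s (Suc j)))"
    using \<open>0 < c\<close> s X0_subset by (intro mult_left_mono MX.mdist_le_sum) auto
  then have "ennreal (c * dX (s 0) (s n)) \<le> ennreal (\<Sum>j<n. c * dX (s j) (s (Suc j)))"
    by (intro ennreal_leI) (simp add: sum_distrib_left)
  also have "\<dots> = (\<Sum>j<n. ennreal (c * dX (s j) (s (Suc j))))"
    using \<open>0 < c\<close> by (intro sum_ennreal[symmetric]) auto
  also have "\<dots> \<le> (\<Sum>j<n. ?P (s j) (s (Suc j)))"
    using s by (intro sum_mono P) auto
  finally show "ennreal (c * dX (s 0) (s n)) \<le> (\<Sum>j<n. ?P (s j) (s (Suc j)))" .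
qed

lemma Metric_space_delta:
  assumes "0 < \<theta>" "\<theta> < 1" "1 \<le> q"
  shows "Metric_space (X0 \<inter> X1) (\<lambda>x y. enn2real (delta X0 d0 X1 d1 \<theta> q x y))"
proof
  let ?D = "delta X0 d0 X1 d1 \<theta> q"
  obtain c where c: "0 < c"
    "\<And>x y. x \<in> X0 \<inter> X1 \<Longrightarrow> y \<in> X0 \<inter> X1 \<Longrightarrow> ennreal (c * dX x y) \<le> p_fun X0 d0 X1 d1 \<theta> q x y"
    using p_fun_ge[OF assms] by blast
  fix x y z
  show "0 \<le> enn2real (?D x y)" by simp
  show "enn2real (?D x y) = enn2real (?D y x)" by (simp add: delta_commute)
  show "enn2real (?D x y) = 0 \<longleftrightarrow> x = y" if xy: "x \<in> X0 \<inter> X1" "y \<in> X0 \<inter> X1"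
  proof
    assume "enn2real (?D x y) = 0"
    \<comment> \<open>Finiteness is essential here, because \<open>enn2real\<close> also sends
      \<infinity> to 0.\<close>
    then have "?D x y = 0"
      using delta_finite[OF assms(3) xy, of \<theta>] by (auto simp: enn2real_eq_0_iff)
    then have "ennreal (c * dX x y) \<le> 0" using delta_ge[OF c, of x y] by simp
    then have "dX x y = 0"
      using c(1) MX.nonneg[of x y] by (simp add: mult_le_0_iff)
    then show "x = y" using xy X0_subset MX.zero[of x y] by auto
  qed (use xy in \<open>simp add: delta_refl\<close>)
  show "enn2real (?D x z) \<le> enn2real (?D x y) + enn2real (?D y z)"
    if xyz: "x \<in> X0 \<inter> X1" "y \<in> X0 \<inter> X1" "z \<in> X0 \<inter> X1"
  proof -
    \<comment> \<open>Finiteness makes \<open>enn2real\<close> monotone and additive on these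
      values.\<close>
    have fin: "?D x y < top" "?D y z < top"
      using delta_finite[OF assms(3), of _ _ \<theta>] xyz by auto
    have "enn2real (?D x z) \<le> enn2real (?D x y + ?D y z)"
      using fin by (intro enn2real_mono delta_triangle) auto
    also have "\<dots> = enn2real (?D x y) + enn2real (?D y z)"
      using fin by (rule enn2real_plus)
    finally show ?thesis .
  qed
qed

end

theorem theorem3p2:
  fixes X0 X1 X :: "'a set"
    and d0 d1 dX :: "'a \<Rightarrow> 'a \<Rightarrow> real"
    and \<theta> :: real and q :: ereal
  assumes "compatible_pair X0 d0 X1 d1 X dX"
    and "0 < \<theta>" and "\<theta> < 1" and "1 \<le> q"
  shows "(\<forall>x\<in>X0 \<inter> X1. \<forall>y\<in>X0 \<inter> X1. delta X0 d0 X1 d1 \<theta> q x y < \<infinity>) \<and>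
         Metric_space (X0 \<inter> X1) (\<lambda>x y. enn2real (delta X0 d0 X1 d1 \<theta> q x y))"
proof -
  interpret compatible_pair X0 d0 X1 d1 X dX by (fact assms(1))
  show ?thesis
    using delta_finite Metric_space_delta assms(2-4) by blast
qed

end
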